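(* Let $(X, \delta\colon X \rightarrow (\mathcal{P}_{\omega} X)^A)$ be an LTS. Then for all $x\in X$ and $w\in A^*$, $[\![ \{x\} ]\!](w) = \varphi^{\mathcal{PF}}_{x}(w)$.
   Context: An LTS is a pair $(X,\delta\colon X\to(\mathcal{P}_\omega X)^A)$ ($\mathcal{P}_\omega$ = finite powerset); write $x\xrightarrow{a}y$ iff $y\in\delta(x)(a)$, extended to words. Let $\mathcal{T}(x)=\{w\in A^*\mid\exists x'.\ x\xrightarrow{w}x'\}$ be the set of traces of $x$. The LTS is decorated with $\overline{o}_{\mathcal{PF}}\colon X\to B=\mathcal{P}(\mathcal{P}(A^* ))$, $\overline{o}_{\mathcal{PF}}(x)=\{\mathcal{T}(x)\}$, and determinised into $(\mathcal{P}_\omega X,\langle o,t\rangle)$ with $o(Y)=\bigcup_{y\in Y}\overline{o}_{\mathcal{PF}}(y)$ and $t(Y)(a)=\bigcup_{y\in Y}\delta(y)(a)$; $[\![-]\!]\colon\mathcal{P}_\omega X\to B^{A^*}$ is the unique map into the final Moore coalgebra, $[\![Y]\!](\varepsilon)=o(Y)$, $[\![Y]\!](aw)=[\![t(Y)(a)]\!](w)$. Finally $\varphi^{\mathcal{PF}}_x(w)=\{\mathcal{T}(y)\mid x\xrightarrow{w}y\}$, which encodes the set of possible futures of $x$. *)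

theory Defs
  imports Main "HOL-Library.FSet"
begin

type_synonym ('x, 'a) lts = "'x \<Rightarrow> 'a \<Rightarrow> 'x fset"

inductive steps :: "('x, 'a) lts \<Rightarrow> 'x \<Rightarrow> 'a list \<Rightarrow> 'x \<Rightarrow> bool" for \<delta> where
  steps_Nil: "steps \<delta> x [] x"
| steps_Cons: "y |\<in>| \<delta> x a \<Longrightarrow> steps \<delta> y w z \<Longrightarrow> steps \<delta> x (a # w) z"

definition traces :: "('x, 'a) lts \<Rightarrow> 'x \<Rightarrow> 'a list set" where
  "traces \<delta> x = {w. \<exists>x'. steps \<delta> x w x'}"

definition obar_PF :: "('x, 'a) lts \<Rightarrow> 'x \<Rightarrow> 'a list set set" where
  "obar_PF \<delta> x = {traces \<delta> x}"


subsection \<open>Moore coalgebras and the final semantics\<close>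

text \<open>
  A Moore coalgebra on a state type \<open>'s\<close> with outputs in \<open>'b\<close> and inputs in \<open>'a\<close> is given by
  the two components of its structure map \<open>s \<mapsto> (out s, tr s)\<close>.  The final one has the functions
  \<open>'a list \<Rightarrow> 'b\<close> as states, with output \<open>f []\<close> and derivatives \<open>w \<mapsto> f (a # w)\<close>.
\<close>

definition final_out :: "('a list \<Rightarrow> 'b) \<Rightarrow> 'b" where
  "final_out f = f []"

definition final_tr :: "('a list \<Rightarrow> 'b) \<Rightarrow> 'a \<Rightarrow> 'a list \<Rightarrow> 'b" where
  "final_tr f a = (\<lambda>w. f (a # w))"

definition moore_hom ::
  "('s \<Rightarrow> 'b) \<Rightarrow> ('s \<Rightarrow> 'a \<Rightarrow> 's) \<Rightarrow> ('r \<Rightarrow> 'b) \<Rightarrow> ('r \<Rightarrow> 'a \<Rightarrow> 'r) \<Rightarrow> ('s \<Rightarrow> 'r) \<Rightarrow> bool" where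
  "moore_hom out tr out' tr' h \<longleftrightarrow>
     (\<forall>s. out' (h s) = out s) \<and> (\<forall>s a. tr' (h s) a = h (tr s a))"

fun moore_sem :: "('s \<Rightarrow> 'b) \<Rightarrow> ('s \<Rightarrow> 'a \<Rightarrow> 's) \<Rightarrow> 's \<Rightarrow> 'a list \<Rightarrow> 'b" where
  "moore_sem out tr s [] = out s"
| "moore_sem out tr s (a # w) = moore_sem out tr (tr s a) w"

lemma moore_hom_final_iff:
  "moore_hom out tr final_out final_tr h \<longleftrightarrow> h = moore_sem out tr"
proof
  assume h: "moore_hom out tr final_out final_tr h"
  have "h s w = moore_sem out tr s w" for s w
  proof (induction w arbitrary: s)
    case Nil
    show ?case using h by (simp add: moore_hom_def final_out_def)
  next
    case (Cons a w)
    have "final_tr (h s) a w = h (tr s a) w" using h by (simp add: moore_hom_def)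
    then show ?case using Cons by (simp add: final_tr_def)
  qed
  then show "h = moore_sem out tr" by blast
next
  assume "h = moore_sem out tr"
  then show "moore_hom out tr final_out final_tr h"
    by (auto simp: moore_hom_def final_out_def final_tr_def)
qed


subsection \<open>Determinisation of a decorated LTS\<close>

definition det_out :: "('x \<Rightarrow> 'b set) \<Rightarrow> 'x fset \<Rightarrow> 'b set" where
  "det_out obar Y = (\<Union>y\<in>fset Y. obar y)"

definition det_tr :: "('x, 'a) lts \<Rightarrow> 'x fset \<Rightarrow> 'a \<Rightarrow> 'x fset" where
  "det_tr \<delta> Y a = ffUnion ((\<lambda>y. \<delta> y a) |`| Y)"

definition sem_PF :: "('x, 'a) lts \<Rightarrow> 'x fset \<Rightarrow> 'a list \<Rightarrow> 'a list set set" where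
  "sem_PF \<delta> = moore_sem (det_out (obar_PF \<delta>)) (det_tr \<delta>)"


definition phi_PF :: "('x, 'a) lts \<Rightarrow> 'x \<Rightarrow> 'a list \<Rightarrow> 'a list set set" where
  "phi_PF \<delta> x w = {traces \<delta> y | y. steps \<delta> x w y}"

end

theory Submission
  imports Defs
begin

text \<open>Reading \<open>w\<close> from \<open>Y\<close> in the determinisation leads to the set
  of states reachable by \<open>w\<close> from members of \<open>Y\<close>, so the semantics at
  \<open>w\<close> is the union of their decorations (\<open>moore_sem_det\<close>). For a singleton
  \<open>Y\<close> and decorations \<open>{traces \<delta> z}\<close>, this union is
  \<open>phi_PF\<close>.\<close>

lemma steps_Nil_iff: "steps \<delta> x [] z \<longleftrightarrow> z = x"
  by (auto intro: steps_Nil elim: steps.cases)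

lemma steps_Cons_iff: "steps \<delta> x (a # w) z \<longleftrightarrow> (\<exists>y. y |\<in>| \<delta> x a \<and> steps \<delta> y w z)"
  by (auto intro: steps_Cons elim: steps.cases)

lemma fmember_det_tr_iff: "z |\<in>| det_tr \<delta> Y a \<longleftrightarrow> (\<exists>y. y |\<in>| Y \<and> z |\<in>| \<delta> y a)"
  by (auto simp: det_tr_def ffUnion.rep_eq)

text \<open>Induction on \<open>w\<close> needs all finite \<open>Y\<close>: reading one letter can
  turn a singleton into a larger or empty set.\<close>

lemma moore_sem_det:
  "moore_sem (det_out obar) (det_tr \<delta>) Y w = (\<Union>z\<in>{z. \<exists>y. y |\<in>| Y \<and> steps \<delta> y w z}. obar z)"
proof (induction w arbitrary: Y)
  case Nil
  show ?case by (auto simp: det_out_def steps_Nil_iff)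
next
  case (Cons a w)
  \<comment> \<open>A path labelled \<open>a # w\<close> from \<open>Y\<close> splits after its
    first letter, at a member of \<open>det_tr \<delta> Y a\<close>.\<close>
  have "{z. \<exists>y. y |\<in>| det_tr \<delta> Y a \<and> steps \<delta> y w z} = {z. \<exists>y. y |\<in>| Y \<and> steps \<delta> y (a # w) z}"
    by (auto simp: fmember_det_tr_iff steps_Cons_iff)
  then show ?case by (simp add: Cons.IH)
qed

theorem theorem4p3:
  fixes \<delta> :: "('x, 'a) lts" and x :: 'x and w :: "'a list"
  shows "sem_PF \<delta> {|x|} w = phi_PF \<delta> x w"
  by (auto simp: sem_PF_def phi_PF_def obar_PF_def moore_sem_det)

end
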